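(* Let $\delta t>0$, $K=[T/\delta t]$, and let the sequence $(\phi^{k},\mathbf{u}^k,p^k)$, together with $\mu^{k+\frac12}$ and $\overline{\mathbf{u}}^{k+1}$, be generated by the time-discrete scheme (S1)--(S5) with the boundary conditions (BC) given in the context. Then the scheme is mass-conservative: $$\int_{\Omega}\phi^{k+1}\,dx=\int_{\Omega}\phi^{k}\,dx,\qquad k=0,1,\dots,K-1 .$$
   Context: $\Omega\subseteq\mathbb{R}^d$ ($d=2,3$) is a bounded domain with unit outer normal $\mathbf{n}$ on $\partial\Omega$; $T>0$ is fixed; $\epsilon, Re, We^\ast>0$ are constants (capillary width, Reynolds number, modified Weber number). The mobility $M$ is a function with $m_1\le M(\cdot)\le m_2$ for constants $0<m_1\le m_2$. Notation: $\phi^{k+\frac12}=\frac12(\phi^{k+1}+\phi^k)$, $\widetilde{\phi}^{k+\frac12}=\frac{3\phi^k-\phi^{k-1}}{2}$, $\overline{\mathbf{u}}^{k+\frac12}=\frac{\overline{\mathbf{u}}^{k+1}+\mathbf{u}^k}{2}$, $\widetilde{\mathbf{u}}^{k+\frac12}=\frac{3\mathbf{u}^k-\mathbf{u}^{k-1}}{2}$, and $B(\mathbf{u},\mathbf{v})=(\mathbf{u}\cdot\nabla)\mathbf{v}+\frac12(\nabla\cdot\mathbf{u})\mathbf{v}$. Scheme: the step from $t^k=k\delta t$ to $t^{k+1}$ takes the data $\phi^k,\phi^{k-1},\mathbf{u}^k,\mathbf{u}^{k-1},p^k$ (for the first step, the level $k-1$ data are regarded as given) and produces $\phi^{k+1},\mu^{k+\frac12},\overline{\mathbf{u}}^{k+1},\mathbf{u}^{k+1},p^{k+1}$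 satisfying in $\Omega$ (S1) $\dfrac{\phi^{k+1}-\phi^k}{\delta t}=\nabla\cdot\big(M(\widetilde{\phi}^{k+\frac12})\nabla\mu^{k+\frac12}-\widetilde{\phi}^{k+\frac12}\overline{\mathbf{u}}^{k+\frac12}\big)$, (S2) $\mu^{k+\frac12}=\frac12\big((\phi^{k+1})^2+(\phi^k)^2\big)\phi^{k+\frac12}-\widetilde{\phi}^{k+\frac12}-\epsilon^2\Delta\phi^{k+\frac12}$, (S3) $\dfrac{\overline{\mathbf{u}}^{k+1}-\mathbf{u}^k}{\delta t}-\dfrac1{Re}\Delta\overline{\mathbf{u}}^{k+\frac12}+B(\widetilde{\mathbf{u}}^{k+\frac12},\overline{\mathbf{u}}^{k+\frac12})=-\nabla p^k-\dfrac{\epsilon^{-1}}{We^\ast}\widetilde{\phi}^{k+\frac12}\nabla\mu^{k+\frac12}$, (S4) $\dfrac{\mathbf{u}^{k+1}-\overline{\mathbf{u}}^{k+1}}{\delta t}+\frac12\nabla(p^{k+1}-p^k)=0$, (S5) $\nabla\cdot\mathbf{u}^{k+1}=0$, with boundary conditions (BC) $\nabla\phi^{k+1}\cdot\mathbf{n}=0,\ \nabla\mu^{k+\frac12}\cdot\mathbf{n}=0,\ \overline{\mathbf{u}}^{k+\frac12}=0,\ \mathbf{u}^{k+1}\cdot\mathbf{n}=0$ on $\partial\Omega$. The scheme is understood in strong form: all functions, and the boundary of $\Omega$, are assumed regular enough for the equations to hold and for integration by parts to be valid. *)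

theory Defs
  imports "HOL-Analysis.Analysis"
begin

section \<open>Differential operators\<close>

definition pd :: "'n \<Rightarrow> (real^'n \<Rightarrow> real) \<Rightarrow> real^'n::finite \<Rightarrow> real" where
  "pd i f x = frechet_derivative f (at x) (axis i 1)"

definition grad :: "(real^'n \<Rightarrow> real) \<Rightarrow> real^'n::finite \<Rightarrow> real^'n" where
  "grad f x = (\<chi> i. pd i f x)"

definition dvg :: "(real^'n \<Rightarrow> real^'n) \<Rightarrow> real^'n::finite \<Rightarrow> real" where
  "dvg F x = (\<Sum>i\<in>UNIV. pd i (\<lambda>y. F y $ i) x)"

definition lap :: "(real^'n \<Rightarrow> real) \<Rightarrow> real^'n::finite \<Rightarrow> real" where
  "lap f x = dvg (grad f) x"

definition vlap :: "(real^'n \<Rightarrow> real^'n) \<Rightarrow> real^'n::finite \<Rightarrow> real^'n" where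
  "vlap F x = (\<chi> i. lap (\<lambda>y. F y $ i) x)"

definition convect ::
  "(real^'n \<Rightarrow> real^'n) \<Rightarrow> (real^'n \<Rightarrow> real^'n) \<Rightarrow> real^'n::finite \<Rightarrow> real^'n" where
  "convect u v x = (\<chi> i. \<Sum>j\<in>UNIV. u x $ j * pd j (\<lambda>y. v y $ i) x)
                     + (1/2 * dvg u x) *\<^sub>R v x"

section \<open>Regularity up to the boundary and boundary values\<close>

text \<open>The classical space of functions whose derivatives of order at most the given number exist
  in the open set \<open>\<Omega>\<close> and extend continuously to its closure. Values outside \<open>\<Omega>\<close> play no role.\<close>

primrec Ck_closure :: "nat \<Rightarrow> (real^'n::finite) set \<Rightarrow> (real^'n \<Rightarrow> real) \<Rightarrow> bool" where
  "Ck_closure 0 \<Omega> f \<longleftrightarrow> (\<exists>g. continuous_on (closure \<Omega>) g \<and> (\<forall>x\<in>\<Omega>. g x = f x))"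
| "Ck_closure (Suc m) \<Omega> f \<longleftrightarrow>
     (\<exists>g. continuous_on (closure \<Omega>) g \<and> (\<forall>x\<in>\<Omega>. g x = f x)) \<and>
     (\<forall>x\<in>\<Omega>. f differentiable (at x)) \<and> (\<forall>i. Ck_closure m \<Omega> (pd i f))"

definition vCk_closure :: "nat \<Rightarrow> (real^'n::finite) set \<Rightarrow> (real^'n \<Rightarrow> real^'n) \<Rightarrow> bool" where
  "vCk_closure m \<Omega> F \<longleftrightarrow> (\<forall>i. Ck_closure m \<Omega> (\<lambda>x. F x $ i))"

text \<open>The boundary value at \<open>y\<close> is the limit from inside \<open>\<Omega>\<close>; it exists for every continuously
  extendable \<open>f\<close>.\<close>

definition trace_at :: "(real^'n::finite) set \<Rightarrow> (real^'n \<Rightarrow> 'b::t2_space) \<Rightarrow> real^'n \<Rightarrow> 'b" where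
  "trace_at \<Omega> f y = Lim (at y within \<Omega>) f"

section \<open>Outer normal, surface measure, integration by parts\<close>

text \<open>\<open>\<nu>\<close> is the unit outer normal at \<open>y\<close> if, near \<open>y\<close>, the set contains every cone around
  \<open>-\<nu>\<close> and avoids every cone around \<open>\<nu>\<close> of opening strictly less than a half space, i.e.
  the boundary has the tangent hyperplane orthogonal to \<open>\<nu>\<close> with the set lying on the side of
  \<open>-\<nu>\<close>.\<close>

definition is_outer_normal :: "(real^'n::finite) set \<Rightarrow> real^'n \<Rightarrow> real^'n \<Rightarrow> bool" where
  "is_outer_normal \<Omega> y \<nu> \<longleftrightarrow> y \<in> frontier \<Omega> \<and> norm \<nu> = 1 \<and>
     (\<forall>e>0. \<exists>r>0. \<forall>z\<in>ball y r.
        ((z - y) \<bullet> \<nu> < - e * norm (z - y) \<longrightarrow> z \<in> \<Omega>) \<and>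
        ((z - y) \<bullet> \<nu> > e * norm (z - y) \<longrightarrow> z \<notin> \<Omega>))"

lemma is_outer_normal_unique:
  assumes "is_outer_normal \<Omega> y \<nu>" "is_outer_normal \<Omega> y \<nu>'"
  shows "\<nu> = \<nu>'"
proof (rule ccontr)
  assume ne: "\<nu> \<noteq> \<nu>'"
  have n1: "\<nu> \<bullet> \<nu> = 1" "\<nu>' \<bullet> \<nu>' = 1"
    using assms by (auto simp: is_outer_normal_def dot_square_norm)
  define w where "w = \<nu>' - \<nu>"
  define c where "c = 1 - \<nu> \<bullet> \<nu>'"
  have w0: "norm w > 0" using ne by (simp add: w_def)
  have ww: "w \<bullet> w = 2 * c"
    using n1 by (simp add: w_def c_def inner_diff inner_commute)
  have c: "c > 0" using ww w0 by (metis inner_gt_zero_iff norm_eq_zero less_irrefl mult_pos_pos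
        zero_less_mult_pos zero_less_numeral)
  have wn: "w \<bullet> \<nu> = - c" "w \<bullet> \<nu>' = c"
    using n1 by (simp_all add: w_def c_def inner_diff inner_commute)
  define e where "e = c / (2 * norm w)"
  have e: "e > 0" "e * norm w < c" using c w0 by (simp_all add: e_def)
  obtain r1 where r1: "r1 > 0" "\<And>z. z \<in> ball y r1 \<Longrightarrow> (z - y) \<bullet> \<nu> < - e * norm (z - y) \<Longrightarrow> z \<in> \<Omega>"
    using assms(1) e(1) unfolding is_outer_normal_def by meson
  obtain r2 where r2: "r2 > 0" "\<And>z. z \<in> ball y r2 \<Longrightarrow> (z - y) \<bullet> \<nu>' > e * norm (z - y) \<Longrightarrow> z \<notin> \<Omega>"
    using assms(2) e(1) unfolding is_outer_normal_def by meson
  define t where "t = min r1 r2 / (2 * norm w)"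
  have t: "t > 0" using r1 r2 w0 by (simp add: t_def)
  have tw: "t * norm w < r1" "t * norm w < r2" using r1(1) r2(1) w0 by (auto simp: t_def min_def)
  define z where "z = y + t *\<^sub>R w"
  have zb: "z \<in> ball y r1" "z \<in> ball y r2" using tw t by (auto simp: z_def dist_norm)
  have "t * (e * norm w) < t * c" using e t by simp
  then have "(z - y) \<bullet> \<nu> < - e * norm (z - y)" "(z - y) \<bullet> \<nu>' > e * norm (z - y)"
    using t wn by (simp_all add: z_def algebra_simps)
  then show False using r1 r2 zb by blast
qed

text \<open>Zero at boundary points without a tangent hyperplane (edges and corners), so a condition
  \<open>F \<bullet> n = 0\<close> on the boundary imposes nothing there.\<close>

definition outer_normal :: "(real^'n::finite) set \<Rightarrow> real^'n \<Rightarrow> real^'n" where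
  "outer_normal \<Omega> y =
     (if \<exists>\<nu>. is_outer_normal \<Omega> y \<nu> then THE \<nu>. is_outer_normal \<Omega> y \<nu> else 0)"

definition hausdorff_pre :: "real \<Rightarrow> real \<Rightarrow> 'a::metric_space set \<Rightarrow> ennreal" where
  "hausdorff_pre s r A =
     (INF C \<in> {C :: nat \<Rightarrow> 'a set. A \<subseteq> (\<Union>i. C i) \<and> (\<forall>i. bounded (C i) \<and> diameter (C i) \<le> r)}.
        (\<Sum>i. ennreal (unit_ball_vol s * (diameter (C i) / 2) powr s)))"

definition hausdorff_outer :: "real \<Rightarrow> 'a::metric_space set \<Rightarrow> ennreal" where
  "hausdorff_outer s A = (SUP r\<in>{0<..}. hausdorff_pre s r A)"

text \<open>Surface measure: normalised Hausdorff measure of codimension one, concentrated on the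
  boundary. (A Hausdorff outer measure is countably additive on the Borel sets.)\<close>

definition surface_measure :: "(real^'n::finite) set \<Rightarrow> (real^'n) measure" where
  "surface_measure \<Omega> =
     measure_of UNIV (sets borel) (\<lambda>A. hausdorff_outer (real CARD('n) - 1) (A \<inter> frontier \<Omega>))"

text \<open>Standing regularity of the boundary: the unit outer normal exists almost everywhere on the
  boundary, and integration by parts is valid for functions continuously differentiable up to
  the boundary. Bounded Lipschitz domains have this property.\<close>

definition integration_by_parts_domain :: "(real^'n::finite) set \<Rightarrow> bool" where
  "integration_by_parts_domain \<Omega> \<longleftrightarrow>
     (AE y in surface_measure \<Omega>. \<exists>\<nu>. is_outer_normal \<Omega> y \<nu>) \<and>
     (\<forall>f g i. Ck_closure 1 \<Omega> f \<longrightarrow> Ck_closure 1 \<Omega> g \<longrightarrow>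
        integrable (surface_measure \<Omega>)
          (\<lambda>y. trace_at \<Omega> f y * trace_at \<Omega> g y * outer_normal \<Omega> y $ i) \<and>
        (LINT x:\<Omega>|lborel. f x * pd i g x) =
          (LINT y|surface_measure \<Omega>. trace_at \<Omega> f y * trace_at \<Omega> g y * outer_normal \<Omega> y $ i)
          - (LINT x:\<Omega>|lborel. pd i f x * g x))"

section \<open>The scheme\<close>

definition mid :: "('a \<Rightarrow> 'b::real_vector) \<Rightarrow> ('a \<Rightarrow> 'b) \<Rightarrow> 'a \<Rightarrow> 'b" where
  "mid f g x = (1/2) *\<^sub>R (f x + g x)"

definition extrap :: "('a \<Rightarrow> 'b::real_vector) \<Rightarrow> ('a \<Rightarrow> 'b) \<Rightarrow> 'a \<Rightarrow> 'b" where
  "extrap f f_old x = (1/2) *\<^sub>R (3 *\<^sub>R f x - f_old x)"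

text \<open>One time step in strong form. The data are \<open>\<phi>\<close>, \<open>u\<close>, \<open>p\<close> and, at the previous level,
  \<open>\<phi>_old\<close>, \<open>u_old\<close>; the results are \<open>\<phi>_new\<close>, \<open>\<mu>\<close> (at the half step), \<open>ub\<close> (the intermediate
  velocity), \<open>u_new\<close> and \<open>p_new\<close>. The regularity required of \<open>M\<close> and the second derivatives of
  \<open>\<mu>\<close> only enters through the diffusive flux.\<close>

definition step_regular ::
  "(real^'n::finite) set \<Rightarrow> (real \<Rightarrow> real) \<Rightarrow>
   (real^'n \<Rightarrow> real) \<Rightarrow> (real^'n \<Rightarrow> real) \<Rightarrow> (real^'n \<Rightarrow> real^'n) \<Rightarrow> (real^'n \<Rightarrow> real^'n) \<Rightarrow>
   (real^'n \<Rightarrow> real) \<Rightarrow> (real^'n \<Rightarrow> real) \<Rightarrow> (real^'n \<Rightarrow> real) \<Rightarrow> (real^'n \<Rightarrow> real^'n) \<Rightarrow>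
   (real^'n \<Rightarrow> real^'n) \<Rightarrow> (real^'n \<Rightarrow> real) \<Rightarrow> bool" where
  "step_regular \<Omega> M \<phi>_old \<phi> u_old u p \<phi>_new \<mu> ub u_new p_new \<longleftrightarrow>
     Ck_closure 1 \<Omega> \<phi>_old \<and> Ck_closure 2 \<Omega> \<phi> \<and> Ck_closure 2 \<Omega> \<phi>_new \<and>
     Ck_closure 1 \<Omega> \<mu> \<and> vCk_closure 1 \<Omega> (\<lambda>x. M (extrap \<phi> \<phi>_old x) *\<^sub>R grad \<mu> x) \<and>
     vCk_closure 1 \<Omega> u_old \<and> vCk_closure 1 \<Omega> u \<and> vCk_closure 1 \<Omega> u_new \<and>
     vCk_closure 2 \<Omega> (mid ub u) \<and>
     Ck_closure 1 \<Omega> p \<and> Ck_closure 1 \<Omega> p_new"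

definition step_equations ::
  "(real^'n::finite) set \<Rightarrow> real \<Rightarrow> real \<Rightarrow> real \<Rightarrow> (real \<Rightarrow> real) \<Rightarrow> real \<Rightarrow>
   (real^'n \<Rightarrow> real) \<Rightarrow> (real^'n \<Rightarrow> real) \<Rightarrow> (real^'n \<Rightarrow> real^'n) \<Rightarrow> (real^'n \<Rightarrow> real^'n) \<Rightarrow>
   (real^'n \<Rightarrow> real) \<Rightarrow> (real^'n \<Rightarrow> real) \<Rightarrow> (real^'n \<Rightarrow> real) \<Rightarrow> (real^'n \<Rightarrow> real^'n) \<Rightarrow>
   (real^'n \<Rightarrow> real^'n) \<Rightarrow> (real^'n \<Rightarrow> real) \<Rightarrow> bool" where
  "step_equations \<Omega> \<epsilon> Rey We M \<delta>t \<phi>_old \<phi> u_old u p \<phi>_new \<mu> ub u_new p_new \<longleftrightarrow>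
     (\<forall>x\<in>\<Omega>.
        (\<phi>_new x - \<phi> x) / \<delta>t =
          dvg (\<lambda>y. M (extrap \<phi> \<phi>_old y) *\<^sub>R grad \<mu> y - extrap \<phi> \<phi>_old y *\<^sub>R mid ub u y) x \<and>
        \<mu> x = 1/2 * ((\<phi>_new x)\<^sup>2 + (\<phi> x)\<^sup>2) * mid \<phi>_new \<phi> x - extrap \<phi> \<phi>_old x
                - \<epsilon>\<^sup>2 * lap (mid \<phi>_new \<phi>) x \<and>
        (1 / \<delta>t) *\<^sub>R (ub x - u x) - (1 / Rey) *\<^sub>R vlap (mid ub u) x
            + convect (extrap u u_old) (mid ub u) x =
          - grad p x - (inverse \<epsilon> / We * extrap \<phi> \<phi>_old x) *\<^sub>R grad \<mu> x \<and>
        (1 / \<delta>t) *\<^sub>R (u_new x - ub x) + (1/2) *\<^sub>R grad (\<lambda>y. p_new y - p y) x = 0 \<and>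
        dvg u_new x = 0)"

definition step_boundary ::
  "(real^'n::finite) set \<Rightarrow> (real^'n \<Rightarrow> real^'n) \<Rightarrow>
   (real^'n \<Rightarrow> real) \<Rightarrow> (real^'n \<Rightarrow> real) \<Rightarrow> (real^'n \<Rightarrow> real^'n) \<Rightarrow> (real^'n \<Rightarrow> real^'n) \<Rightarrow> bool" where
  "step_boundary \<Omega> u \<phi>_new \<mu> ub u_new \<longleftrightarrow>
     (\<forall>y\<in>frontier \<Omega>.
        trace_at \<Omega> (grad \<phi>_new) y \<bullet> outer_normal \<Omega> y = 0 \<and>
        trace_at \<Omega> (grad \<mu>) y \<bullet> outer_normal \<Omega> y = 0 \<and>
        trace_at \<Omega> (mid ub u) y = 0 \<and>
        trace_at \<Omega> u_new y \<bullet> outer_normal \<Omega> y = 0)"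

definition scheme_step ::
  "(real^'n::finite) set \<Rightarrow> real \<Rightarrow> real \<Rightarrow> real \<Rightarrow> (real \<Rightarrow> real) \<Rightarrow> real \<Rightarrow>
   (real^'n \<Rightarrow> real) \<Rightarrow> (real^'n \<Rightarrow> real) \<Rightarrow> (real^'n \<Rightarrow> real^'n) \<Rightarrow> (real^'n \<Rightarrow> real^'n) \<Rightarrow>
   (real^'n \<Rightarrow> real) \<Rightarrow> (real^'n \<Rightarrow> real) \<Rightarrow> (real^'n \<Rightarrow> real) \<Rightarrow> (real^'n \<Rightarrow> real^'n) \<Rightarrow>
   (real^'n \<Rightarrow> real^'n) \<Rightarrow> (real^'n \<Rightarrow> real) \<Rightarrow> bool" where
  "scheme_step \<Omega> \<epsilon> Rey We M \<delta>t \<phi>_old \<phi> u_old u p \<phi>_new \<mu> ub u_new p_new \<longleftrightarrow>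
     step_regular \<Omega> M \<phi>_old \<phi> u_old u p \<phi>_new \<mu> ub u_new p_new \<and>
     step_equations \<Omega> \<epsilon> Rey We M \<delta>t \<phi>_old \<phi> u_old u p \<phi>_new \<mu> ub u_new p_new \<and>
     step_boundary \<Omega> u \<phi>_new \<mu> ub u_new"

end

theory Submission
  imports Defs
begin

text \<open>
  By the phase equation, the rate \<open>(\<phi>_new - \<phi>) / \<delta>t\<close> is the divergence of the total flux
  \<open>F = M(\<phi>~) \<nabla>\<mu> - \<phi>~ u\<close>, with \<open>\<phi>~\<close> the extrapolated phase and \<open>u\<close> the half-step velocity, so
  by the divergence theorem its integral over \<open>\<Omega>\<close> equals the flux of \<open>F\<close> through the boundary.
  That flux vanishes pointwise: the convective part because \<open>u\<close> tends to zero there and \<open>\<phi>~\<close> has a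
  finite limit, the diffusive part because \<open>\<nabla>\<mu> \<bullet> n = 0\<close> and \<open>M\<close> is bounded.

  Boundary values are limits from inside, and \<open>M\<close> may be discontinuous, so the trace of
  \<open>M(\<phi>~) \<nabla>\<mu>\<close> need not be the product of a trace of \<open>M(\<phi>~)\<close> with that of \<open>\<nabla>\<mu>\<close>. The argument in
  \<open>trace_scaled_tangential\<close> therefore passes to the limit in the scalar \<open>M(\<phi>~) (\<nabla>\<mu> \<bullet> \<nu>)\<close>, with
  the boundary normal \<open>\<nu>\<close> held fixed: a bounded function times one tending to zero.

  The divergence theorem (\<open>divergence_theorem\<close>) is integration by parts against the constant
  function one, summed over the coordinates. It applies to \<open>F\<close> because the spaces of functions
  differentiable up to the boundary are algebras (\<open>Ck_closure_add\<close>, \<open>Ck_closure_mult\<close>).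
\<close>

section \<open>Partial derivatives\<close>

lemma pd_eqI:
  assumes "(f has_derivative f') (at x)"
  shows "pd i f x = f' (axis i 1)"
  using frechet_derivative_at[OF assms] by (simp add: pd_def)

lemma pd_cong_open:
  assumes "open \<Omega>" "x \<in> \<Omega>" "\<And>z. z \<in> \<Omega> \<Longrightarrow> f z = g z"
  shows "pd i f x = pd i g x"
proof -
  have "(f has_derivative D) (at x) \<longleftrightarrow> (g has_derivative D) (at x)" for D
    by (auto intro: has_derivative_transform_within_open[OF _ assms(1,2)] simp: assms(3))
  then show ?thesis by (simp add: pd_def frechet_derivative_def)
qed

lemma pd_const: "pd i (\<lambda>x. c) x = 0"
  by (subst pd_eqI[OF has_derivative_const]) simp

lemma pd_add:
  assumes "f differentiable (at x)" "g differentiable (at x)"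
  shows "pd i (\<lambda>x. f x + g x) x = pd i f x + pd i g x"
proof -
  obtain f' g' where D: "(f has_derivative f') (at x)" "(g has_derivative g') (at x)"
    using assms unfolding differentiable_def by blast
  show ?thesis
    by (simp add: pd_eqI[OF has_derivative_add[OF D]] pd_eqI[OF D(1)] pd_eqI[OF D(2)])
qed

lemma pd_mult:
  assumes "f differentiable (at x)" "g differentiable (at x)"
  shows "pd i (\<lambda>x. f x * g x) x = f x * pd i g x + pd i f x * g x"
proof -
  obtain f' g' where D: "(f has_derivative f') (at x)" "(g has_derivative g') (at x)"
    using assms unfolding differentiable_def by blast
  show ?thesis
    by (simp add: pd_eqI[OF has_derivative_mult[OF D]] pd_eqI[OF D(1)] pd_eqI[OF D(2)])
qed

section \<open>The algebra of functions differentiable up to the boundary\<close>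

lemma Ck_closure_extension:
  "Ck_closure m \<Omega> f \<Longrightarrow> \<exists>g. continuous_on (closure \<Omega>) g \<and> (\<forall>x\<in>\<Omega>. g x = f x)"
  by (cases m) auto

lemma Ck_closure_cong:
  assumes "open \<Omega>"
  shows "(\<And>x. x \<in> \<Omega> \<Longrightarrow> f x = g x) \<Longrightarrow> Ck_closure m \<Omega> f \<Longrightarrow> Ck_closure m \<Omega> g"
proof (induction m arbitrary: f g)
  case 0
  then show ?case by auto
next
  case (Suc m)
  have "g differentiable (at x)" if "x \<in> \<Omega>" for x
  proof -
    obtain D where "(f has_derivative D) (at x)"
      using Suc.prems(2) \<open>x \<in> \<Omega>\<close> by (auto simp: differentiable_def)
    then have "(g has_derivative D) (at x)"
      by (rule has_derivative_transform_within_open[OF _ assms \<open>x \<in> \<Omega>\<close>]) (rule Suc.prems(1))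
    then show ?thesis by (auto simp: differentiable_def)
  qed
  moreover have "Ck_closure m \<Omega> (pd i g)" for i
  proof (rule Suc.IH[of "pd i f"])
    show "pd i f x = pd i g x" if "x \<in> \<Omega>" for x
      by (rule pd_cong_open[OF assms that]) (rule Suc.prems(1))
    show "Ck_closure m \<Omega> (pd i f)" using Suc.prems(2) by simp
  qed
  ultimately show ?case using Suc.prems by auto
qed

lemma Ck_closure_SucD: "Ck_closure (Suc m) \<Omega> f \<Longrightarrow> Ck_closure m \<Omega> f"
proof (induction m arbitrary: f)
  case 0
  then show ?case by simp
next
  case (Suc m)
  then have "Ck_closure m \<Omega> (pd i f)" for i
    by (intro Suc.IH) simp
  with Suc.prems show ?case by simp
qed

lemma Ck_closure_const: "Ck_closure m \<Omega> (\<lambda>x. c)"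
proof (induction m arbitrary: c)
  case 0
  show ?case by (auto intro: exI[of _ "\<lambda>x. c"] continuous_on_const)
next
  case (Suc m)
  have "pd i (\<lambda>x. c) = (\<lambda>x. 0)" for i :: 'a
    by (rule ext) (rule pd_const)
  with Suc show ?case by (auto intro: exI[of _ "\<lambda>x. c"] continuous_on_const)
qed

lemma Ck_closure_add:
  assumes "open \<Omega>"
  shows "Ck_closure m \<Omega> f \<Longrightarrow> Ck_closure m \<Omega> g \<Longrightarrow> Ck_closure m \<Omega> (\<lambda>x. f x + g x)"
proof (induction m arbitrary: f g)
  case 0
  then obtain f' g' where "continuous_on (closure \<Omega>) f'" "continuous_on (closure \<Omega>) g'"
    "\<forall>x\<in>\<Omega>. f' x = f x" "\<forall>x\<in>\<Omega>. g' x = g x" by auto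
  then show ?case
    by (auto intro!: exI[of _ "\<lambda>x. f' x + g' x"] continuous_on_add)
next
  case (Suc m)
  have "Ck_closure 0 \<Omega> f" "Ck_closure 0 \<Omega> g" using Suc.prems by auto
  then obtain f' g' where "continuous_on (closure \<Omega>) f'" "continuous_on (closure \<Omega>) g'"
    "\<forall>x\<in>\<Omega>. f' x = f x" "\<forall>x\<in>\<Omega>. g' x = g x" by auto
  then have "\<exists>h. continuous_on (closure \<Omega>) h \<and> (\<forall>x\<in>\<Omega>. h x = f x + g x)"
    by (auto intro!: exI[of _ "\<lambda>x. f' x + g' x"] continuous_on_add)
  moreover have "Ck_closure m \<Omega> (pd i (\<lambda>x. f x + g x))" for i
    by (rule Ck_closure_cong[OF assms _ Suc.IH[of "pd i f" "pd i g"]])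
      (use Suc.prems in \<open>auto simp: pd_add\<close>)
  moreover have "\<forall>x\<in>\<Omega>. (\<lambda>x. f x + g x) differentiable (at x)"
    using Suc.prems by simp
  ultimately show ?case by simp
qed

lemma Ck_closure_mult:
  assumes "open \<Omega>"
  shows "Ck_closure m \<Omega> f \<Longrightarrow> Ck_closure m \<Omega> g \<Longrightarrow> Ck_closure m \<Omega> (\<lambda>x. f x * g x)"
proof (induction m arbitrary: f g)
  case 0
  then obtain f' g' where "continuous_on (closure \<Omega>) f'" "continuous_on (closure \<Omega>) g'"
    "\<forall>x\<in>\<Omega>. f' x = f x" "\<forall>x\<in>\<Omega>. g' x = g x" by auto
  then show ?case
    by (auto intro!: exI[of _ "\<lambda>x. f' x * g' x"] continuous_on_mult)
next
  case (Suc m)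
  have "Ck_closure 0 \<Omega> f" "Ck_closure 0 \<Omega> g" using Suc.prems by auto
  then obtain f' g' where "continuous_on (closure \<Omega>) f'" "continuous_on (closure \<Omega>) g'"
    "\<forall>x\<in>\<Omega>. f' x = f x" "\<forall>x\<in>\<Omega>. g' x = g x" by auto
  then have "\<exists>h. continuous_on (closure \<Omega>) h \<and> (\<forall>x\<in>\<Omega>. h x = f x * g x)"
    by (auto intro!: exI[of _ "\<lambda>x. f' x * g' x"] continuous_on_mult)
  moreover have "Ck_closure m \<Omega> (pd i (\<lambda>x. f x * g x))" for i
  proof (rule Ck_closure_cong[OF assms])
    show "Ck_closure m \<Omega> (\<lambda>x. f x * pd i g x + pd i f x * g x)"
      using Suc.prems Ck_closure_SucD[OF Suc.prems(1)] Ck_closure_SucD[OF Suc.prems(2)]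
      by (intro Ck_closure_add[OF assms] Suc.IH) auto
  qed (use Suc.prems in \<open>auto simp: pd_mult\<close>)
  moreover have "\<forall>x\<in>\<Omega>. (\<lambda>x. f x * g x) differentiable (at x)"
    using Suc.prems by simp
  ultimately show ?case by simp
qed

lemma Ck_closure_diff:
  assumes "open \<Omega>" "Ck_closure m \<Omega> f" "Ck_closure m \<Omega> g"
  shows "Ck_closure m \<Omega> (\<lambda>x. f x - g x)"
  using Ck_closure_add[OF assms(1,2) Ck_closure_mult[OF assms(1) Ck_closure_const[of _ _ "-1"] assms(3)]]
  by simp

lemma Ck_closure_set_integrable:
  assumes "open \<Omega>" "bounded \<Omega>" "Ck_closure m \<Omega> f"
  shows "set_integrable lborel \<Omega> f"
proof -
  obtain g where g: "continuous_on (closure \<Omega>) g" "\<forall>x\<in>\<Omega>. g x = f x"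
    using Ck_closure_extension[OF assms(3)] by blast
  have "set_integrable lborel (closure \<Omega>) g"
    using assms(2) g(1) by (intro borel_integrable_compact[folded set_integrable_def])
      (auto simp: set_integrable_def)
  then have "set_integrable lborel \<Omega> g"
    by (rule set_integrable_subset) (use assms(1) closure_subset in auto)
  then show ?thesis
    using g(2) by (subst set_integrable_cong[OF refl refl, of _ _ g]) auto
qed

section \<open>Boundary values and the divergence theorem\<close>

lemma at_within_frontier_neq_bot:
  assumes "open \<Omega>" "y \<in> frontier \<Omega>"
  shows "at y within \<Omega> \<noteq> bot"
proof -
  have "y \<in> closure \<Omega>" "y \<notin> \<Omega>"
    using assms by (auto simp: frontier_def interior_open)
  then show ?thesis
    by (auto simp: closure_def trivial_limit_within)
qed

lemma tendsto_trace_atI: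
  assumes "open \<Omega>" "y \<in> frontier \<Omega>" "(f \<longlongrightarrow> l) (at y within \<Omega>)"
  shows "(f \<longlongrightarrow> trace_at \<Omega> f y) (at y within \<Omega>)"
  using tendsto_Lim[OF at_within_frontier_neq_bot[OF assms(1,2)] assms(3)] assms(3)
  by (simp add: trace_at_def)

lemma Ck_closure_has_limit:
  assumes "Ck_closure m \<Omega> f" "y \<in> frontier \<Omega>"
  shows "\<exists>l. (f \<longlongrightarrow> l) (at y within \<Omega>)"
proof -
  obtain g where g: "continuous_on (closure \<Omega>) g" "\<forall>x\<in>\<Omega>. g x = f x"
    using Ck_closure_extension[OF assms(1)] by blast
  have "y \<in> closure \<Omega>" using assms(2) by (simp add: frontier_def)
  then have "(g \<longlongrightarrow> g y) (at y within \<Omega>)"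
    using g(1) by (auto simp: continuous_on_def intro: tendsto_within_subset[OF _ closure_subset])
  then have "(f \<longlongrightarrow> g y) (at y within \<Omega>)"
    by (rule Lim_transform_eventually) (use g(2) in \<open>auto simp: eventually_at_filter\<close>)
  then show ?thesis by blast
qed

lemma vCk_closure_tendsto_trace:
  assumes "open \<Omega>" "vCk_closure m \<Omega> F" "y \<in> frontier \<Omega>"
  shows "(F \<longlongrightarrow> trace_at \<Omega> F y) (at y within \<Omega>)"
proof -
  have "\<forall>i. \<exists>l. ((\<lambda>x. F x $ i) \<longlongrightarrow> l) (at y within \<Omega>)"
    using Ck_closure_has_limit assms(2,3) unfolding vCk_closure_def by blast
  then obtain l where "\<And>i. ((\<lambda>x. F x $ i) \<longlongrightarrow> l i) (at y within \<Omega>)"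
    by metis
  then have "(F \<longlongrightarrow> (\<chi> i. l i)) (at y within \<Omega>)"
    by (intro vec_tendstoI) simp
  then show ?thesis by (rule tendsto_trace_atI[OF assms(1,3)])
qed

text \<open>The surface measure is a measure on the whole space, so identities between boundary
  integrands must also hold off the boundary, where the limits defining the traces may be
  meaningless; there the normal has its default value.\<close>

lemma outer_normal_off_frontier:
  "y \<notin> frontier \<Omega> \<Longrightarrow> outer_normal \<Omega> y = 0"
  by (auto simp: outer_normal_def is_outer_normal_def)

lemma trace_component_outer_normal:
  assumes "open \<Omega>" "vCk_closure m \<Omega> F"
  shows "trace_at \<Omega> (\<lambda>x. F x $ i) y * outer_normal \<Omega> y $ i
       = trace_at \<Omega> F y $ i * outer_normal \<Omega> y $ i"
proof (cases "y \<in> frontier \<Omega>")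
  case True
  have "trace_at \<Omega> (\<lambda>x. F x $ i) y = trace_at \<Omega> F y $ i"
    unfolding trace_at_def[of \<Omega> "\<lambda>x. F x $ i"]
    by (intro tendsto_Lim tendsto_vec_nth at_within_frontier_neq_bot
        vCk_closure_tendsto_trace[OF assms] assms True)
  then show ?thesis by simp
qed (simp add: outer_normal_off_frontier)

text \<open>Integration by parts of each component against the constant function one, whose
  derivatives vanish.\<close>

lemma divergence_theorem:
  fixes \<Omega> :: "(real^'n::finite) set"
  assumes "open \<Omega>" "bounded \<Omega>" "integration_by_parts_domain \<Omega>" "vCk_closure 1 \<Omega> F"
  shows "(LINT x:\<Omega>|lborel. dvg F x)
       = (LINT y|surface_measure \<Omega>. trace_at \<Omega> F y \<bullet> outer_normal \<Omega> y)"
proof -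
  have C1: "Ck_closure 1 \<Omega> (\<lambda>x. F x $ i)" for i
    using assms(4) by (simp add: vCk_closure_def)
  have one: "trace_at \<Omega> (\<lambda>x. 1) y * a * outer_normal \<Omega> y $ i = a * outer_normal \<Omega> y $ i"
    for a :: real and y i
  proof (cases "y \<in> frontier \<Omega>")
    case True
    have "trace_at \<Omega> (\<lambda>x. 1 :: real) y = 1"
      unfolding trace_at_def
      by (intro tendsto_Lim tendsto_const at_within_frontier_neq_bot assms True)
    then show ?thesis by simp
  qed (simp add: outer_normal_off_frontier)
  have ibp: "integrable (surface_measure \<Omega>) (\<lambda>y. trace_at \<Omega> F y $ i * outer_normal \<Omega> y $ i)"
    "(LINT x:\<Omega>|lborel. pd i (\<lambda>y. F y $ i) x)
      = (LINT y|surface_measure \<Omega>. trace_at \<Omega> F y $ i * outer_normal \<Omega> y $ i)" for i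
  proof -
    have "integrable (surface_measure \<Omega>)
          (\<lambda>y. trace_at \<Omega> (\<lambda>x. 1) y * trace_at \<Omega> (\<lambda>x. F x $ i) y * outer_normal \<Omega> y $ i) \<and>
        (LINT x:\<Omega>|lborel. 1 * pd i (\<lambda>x. F x $ i) x) =
          (LINT y|surface_measure \<Omega>.
             trace_at \<Omega> (\<lambda>x. 1) y * trace_at \<Omega> (\<lambda>x. F x $ i) y * outer_normal \<Omega> y $ i)
          - (LINT x:\<Omega>|lborel. pd i (\<lambda>x. 1) x * F x $ i)"
      using assms(3) C1[of i] Ck_closure_const unfolding integration_by_parts_domain_def by blast
    then show "integrable (surface_measure \<Omega>) (\<lambda>y. trace_at \<Omega> F y $ i * outer_normal \<Omega> y $ i)"
      "(LINT x:\<Omega>|lborel. pd i (\<lambda>y. F y $ i) x)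
      = (LINT y|surface_measure \<Omega>. trace_at \<Omega> F y $ i * outer_normal \<Omega> y $ i)"
      unfolding one trace_component_outer_normal[OF assms(1,4)] by (simp_all add: pd_const)
  qed
  have int: "set_integrable lborel \<Omega> (pd i (\<lambda>y. F y $ i))" for i
    using C1[of i] by (intro Ck_closure_set_integrable[OF assms(1,2), of 0]) simp
  have "(LINT x:\<Omega>|lborel. dvg F x) = (\<Sum>i\<in>UNIV. LINT x:\<Omega>|lborel. pd i (\<lambda>y. F y $ i) x)"
    unfolding dvg_def set_lebesgue_integral_def scaleR_sum_right
    by (intro Bochner_Integration.integral_sum) (use int in \<open>simp add: set_integrable_def\<close>)
  also have "\<dots> = (LINT y|surface_measure \<Omega>. (\<Sum>i\<in>UNIV. trace_at \<Omega> F y $ i * outer_normal \<Omega> y $ i))"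
    unfolding ibp(2) by (intro Bochner_Integration.integral_sum[symmetric] ibp(1))
  finally show ?thesis by (simp add: inner_vec_def)
qed

section \<open>Vanishing of the boundary flux\<close>

text \<open>The coefficient \<open>c\<close> is only bounded, so it need not have a boundary value: the limit is
  taken in the normal component, along the normal at the fixed boundary point.\<close>

lemma trace_scaled_tangential:
  assumes "open \<Omega>" "y \<in> frontier \<Omega>"
    and G: "vCk_closure m \<Omega> G" "trace_at \<Omega> G y \<bullet> \<nu> = 0"
    and cG: "vCk_closure k \<Omega> (\<lambda>x. c x *\<^sub>R G x)"
    and c: "\<And>x. \<bar>c x\<bar> \<le> b"
  shows "trace_at \<Omega> (\<lambda>x. c x *\<^sub>R G x) y \<bullet> \<nu> = 0"
proof (rule tendsto_unique[OF at_within_frontier_neq_bot[OF assms(1,2)]])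
  show "((\<lambda>x. (c x *\<^sub>R G x) \<bullet> \<nu>) \<longlongrightarrow> trace_at \<Omega> (\<lambda>x. c x *\<^sub>R G x) y \<bullet> \<nu>) (at y within \<Omega>)"
    by (intro tendsto_inner tendsto_const vCk_closure_tendsto_trace[OF assms(1) cG assms(2)])
  have "((\<lambda>x. G x \<bullet> \<nu>) \<longlongrightarrow> trace_at \<Omega> G y \<bullet> \<nu>) (at y within \<Omega>)"
    by (intro tendsto_inner tendsto_const vCk_closure_tendsto_trace[OF assms(1) G(1) assms(2)])
  then have "((\<lambda>x. b * \<bar>G x \<bullet> \<nu>\<bar>) \<longlongrightarrow> 0) (at y within \<Omega>)"
    unfolding G(2) by (intro tendsto_mult_right_zero tendsto_rabs_zero)
  then show "((\<lambda>x. (c x *\<^sub>R G x) \<bullet> \<nu>) \<longlongrightarrow> 0) (at y within \<Omega>)"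
    by (rule Lim_null_comparison[rotated])
      (auto simp: abs_mult intro!: always_eventually mult_right_mono c)
qed

lemma tendsto_scaled_zero_trace:
  assumes "open \<Omega>" "y \<in> frontier \<Omega>" "Ck_closure m \<Omega> f" "vCk_closure k \<Omega> v" "trace_at \<Omega> v y = 0"
  shows "((\<lambda>x. f x *\<^sub>R v x) \<longlongrightarrow> 0) (at y within \<Omega>)"
proof -
  obtain l where "(f \<longlongrightarrow> l) (at y within \<Omega>)"
    using Ck_closure_has_limit assms(2,3) by blast
  from tendsto_scaleR[OF this vCk_closure_tendsto_trace[OF assms(1,4,2)]] show ?thesis
    by (simp add: assms(5))
qed

section \<open>Conservation of mass\<close>

lemma scheme_step_mass_conservative:
  fixes \<Omega> :: "(real^'n::finite) set"
  assumes \<Omega>: "open \<Omega>" "bounded \<Omega>" "integration_by_parts_domain \<Omega>"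
    and M: "\<And>s. \<bar>M s\<bar> \<le> b"
    and "\<delta>t \<noteq> 0"
    and step: "scheme_step \<Omega> \<epsilon> Rey We M \<delta>t \<phi>_old \<phi> u_old u p \<phi>_new \<mu> ub u_new p_new"
  shows "(LINT x:\<Omega>|lborel. \<phi>_new x) = (LINT x:\<Omega>|lborel. \<phi> x)"
proof -
  define \<psi> where "\<psi> = extrap \<phi> \<phi>_old"
  define v where "v = mid ub u"
  define J where "J = (\<lambda>x. M (\<psi> x) *\<^sub>R grad \<mu> x)"
  define F where "F = (\<lambda>x. J x - \<psi> x *\<^sub>R v x)"
  have reg: "Ck_closure 1 \<Omega> \<phi>_old" "Ck_closure 1 \<Omega> \<phi>" "Ck_closure 1 \<Omega> \<phi>_new"
    "Ck_closure 1 \<Omega> \<mu>" "vCk_closure 1 \<Omega> J" "vCk_closure 1 \<Omega> v"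
    using step Ck_closure_SucD[of 1 \<Omega>]
    by (auto simp: scheme_step_def step_regular_def J_def \<psi>_def v_def vCk_closure_def
        numeral_2_eq_2)
  have grad: "vCk_closure 0 \<Omega> (grad \<mu>)"
    using reg(4) by (simp add: vCk_closure_def grad_def del: Ck_closure.simps(1))
  have \<psi>: "Ck_closure 1 \<Omega> \<psi>"
  proof -
    have "Ck_closure 1 \<Omega> (\<lambda>x. (1/2) * (3 * \<phi> x - \<phi>_old x))"
      by (intro Ck_closure_mult Ck_closure_diff Ck_closure_const \<Omega> reg)
    moreover have "\<psi> = (\<lambda>x. (1/2) * (3 * \<phi> x - \<phi>_old x))"
      by (auto simp: \<psi>_def extrap_def fun_eq_iff)
    ultimately show ?thesis by simp
  qed
  have F: "vCk_closure 1 \<Omega> F"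
    unfolding vCk_closure_def
  proof
    fix i
    have "Ck_closure 1 \<Omega> (\<lambda>x. J x $ i - \<psi> x * v x $ i)"
      using reg \<psi> by (intro Ck_closure_mult Ck_closure_diff \<Omega>) (auto simp: vCk_closure_def)
    then show "Ck_closure 1 \<Omega> (\<lambda>x. F x $ i)" by (simp add: F_def)
  qed
  \<comment> \<open>At edges and corners the normal is zero by convention, so all \<open>y\<close> are covered.\<close>
  have no_flux: "trace_at \<Omega> F y \<bullet> outer_normal \<Omega> y = 0" for y
  proof (cases "y \<in> frontier \<Omega>")
    case True
    then have bc: "trace_at \<Omega> (grad \<mu>) y \<bullet> outer_normal \<Omega> y = 0" "trace_at \<Omega> v y = 0"
      using step by (auto simp: scheme_step_def step_boundary_def v_def)
    have "(F \<longlongrightarrow> trace_at \<Omega> J y - 0) (at y within \<Omega>)"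
      unfolding F_def using bc(2)
      by (intro tendsto_diff vCk_closure_tendsto_trace[OF \<Omega>(1) reg(5) True]
          tendsto_scaled_zero_trace[OF \<Omega>(1) True \<psi> reg(6)])
    then have "trace_at \<Omega> F y = trace_at \<Omega> J y"
      unfolding trace_at_def[of \<Omega> F]
      using tendsto_Lim[OF at_within_frontier_neq_bot[OF \<Omega>(1) True]] by simp
    moreover have "trace_at \<Omega> J y \<bullet> outer_normal \<Omega> y = 0"
      unfolding J_def
      by (rule trace_scaled_tangential[OF \<Omega>(1) True grad bc(1) reg(5)[unfolded J_def] M])
    ultimately show ?thesis by simp
  qed (simp add: outer_normal_off_frontier)
  have "(LINT x:\<Omega>|lborel. (\<phi>_new x - \<phi> x) / \<delta>t) = (LINT x:\<Omega>|lborel. dvg F x)"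
    using step \<Omega>(1)
    by (intro set_lebesgue_integral_cong)
      (auto simp: scheme_step_def step_equations_def F_def J_def \<psi>_def v_def)
  also have "\<dots> = 0"
    unfolding divergence_theorem[OF \<Omega> F] no_flux by simp
  finally have "(LINT x:\<Omega>|lborel. \<phi>_new x - \<phi> x) = 0"
    using \<open>\<delta>t \<noteq> 0\<close> by simp
  moreover have "(LINT x:\<Omega>|lborel. \<phi>_new x - \<phi> x)
      = (LINT x:\<Omega>|lborel. \<phi>_new x) - (LINT x:\<Omega>|lborel. \<phi> x)"
    by (intro set_integral_diff Ck_closure_set_integrable[OF \<Omega>(1,2) reg(3)]
        Ck_closure_set_integrable[OF \<Omega>(1,2) reg(2)])
  ultimately show ?thesis by simp
qed

theorem proposition3p1:
  fixes \<Omega> :: "(real^'n::finite) set"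
    and T \<delta>t \<epsilon> Rey We m1 m2 :: real
    and M :: "real \<Rightarrow> real"
    and \<phi> \<mu> p :: "int \<Rightarrow> real^'n \<Rightarrow> real"
    and u ub :: "int \<Rightarrow> real^'n \<Rightarrow> real^'n"
    and K :: int
  assumes dim: "CARD('n) = 2 \<or> CARD('n) = 3"
    and domain: "open \<Omega>" "connected \<Omega>" "\<Omega> \<noteq> {}" "bounded \<Omega>" "integration_by_parts_domain \<Omega>"
    and params: "T > 0" "\<epsilon> > 0" "Rey > 0" "We > 0"
    and mobility: "0 < m1" "m1 \<le> m2" "\<And>s. m1 \<le> M s \<and> M s \<le> m2"
    and time: "\<delta>t > 0" "K = \<lfloor>T / \<delta>t\<rfloor>"
    and scheme: "\<And>k. 0 \<le> k \<Longrightarrow> k \<le> K - 1 \<Longrightarrow>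
      scheme_step \<Omega> \<epsilon> Rey We M \<delta>t (\<phi> (k - 1)) (\<phi> k) (u (k - 1)) (u k) (p k)
        (\<phi> (k + 1)) (\<mu> k) (ub (k + 1)) (u (k + 1)) (p (k + 1))"
  shows "\<forall>k. 0 \<le> k \<and> k \<le> K - 1 \<longrightarrow>
    (LINT x:\<Omega>|lborel. \<phi> (k + 1) x) = (LINT x:\<Omega>|lborel. \<phi> k x)"
proof (intro allI impI)
  fix k assume k: "0 \<le> k \<and> k \<le> K - 1"
  have "\<bar>M s\<bar> \<le> m2" for s
    using mobility(1) mobility(3)[of s] by simp
  moreover have "\<delta>t \<noteq> 0" using time(1) by simp
  ultimately show "(LINT x:\<Omega>|lborel. \<phi> (k + 1) x) = (LINT x:\<Omega>|lborel. \<phi> k x)"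
    using scheme_step_mass_conservative[OF domain(1,4,5) _ _ scheme] k by blast
qed

end
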